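(* For every integer $m\ge1$, $${}_m\tilde\gamma_0=\frac{\gamma^{m+1}}{m+1}+(-1)^{m+1}\frac{\zeta(m+1)}{m+1}+\sum_{k=0}^{m-2}\binom{m+1}{k+1}\frac{(-1)^{k+m}\,\mathcal{H}^{k+1}(m-k)}{m+1}.$$
   Context: $H_n=1+\frac12+\cdots+\frac1n$; for integers $j\ge 0$, $\mathcal{H}^j(s)=\sum_{n\ge1}H_n^j n^{-s}$ for $\Re(s)>1$, meromorphically continued to $\mathbb{C}$ (so $\mathcal{H}^{k+1}(m-k)$ with $m-k\ge2$ is a convergent series). $\zeta$ is the Riemann zeta function and $\gamma$ the Euler–Mascheroni constant. The constant ${}_m\tilde\gamma_0$ is the constant term in the Laurent expansion about $s=1$: $\mathcal{H}^m(s)=\sum_{j=0}^m\binom{m}{j}\gamma^{m-j}j!\,(s-1)^{-j-1}+\sum_{n\ge0}\frac{(-1)^n}{n!}{}_m\tilde\gamma_n(s-1)^n$. *)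

theory Defs
  imports "HOL-Complex_Analysis.Complex_Analysis"
begin

text \<open>
  The meromorphic continuation to the whole complex plane of a function given on the
  half-plane \<open>Re s > 1\<close>. It is unique as a function (and not only up to a sparse set of
  exceptional points) because \<^const>\<open>nicely_meromorphic_on\<close> excludes removable singularities
  and fixes the value at each pole to be 0.
\<close>

definition mero_cont :: "(complex \<Rightarrow> complex) \<Rightarrow> complex \<Rightarrow> complex" where
  "mero_cont f = (THE F. F nicely_meromorphic_on UNIV \<and> (\<forall>s. Re s > 1 \<longrightarrow> F s = f s))"

definition riemann_zeta :: "complex \<Rightarrow> complex" where
  "riemann_zeta = mero_cont (\<lambda>s. \<Sum>n. 1 / of_nat (Suc n) powr s)"

definition harm_zeta :: "nat \<Rightarrow> complex \<Rightarrow> complex" where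
  "harm_zeta j = mero_cont (\<lambda>s. \<Sum>n. harm (Suc n) ^ j / of_nat (Suc n) powr s)"

text \<open>
  In the Laurent expansion of \<^term>\<open>harm_zeta m\<close> about 1, the principal part only contributes
  to the coefficients of negative index, so the coefficient of \<open>(s - 1) ^ n\<close> is
  \<open>(-1) ^ n / fact n * harm_stieltjes m n\<close> for all \<open>n \<ge> 0\<close>. In particular,
  \<open>harm_stieltjes m 0\<close> is the constant term.
\<close>

definition harm_stieltjes :: "nat \<Rightarrow> nat \<Rightarrow> complex" where
  "harm_stieltjes m n =
     (-1) ^ n * fact n * fls_nth (laurent_expansion (harm_zeta m) 1) (int n)"

end

theory Submission
  imports Defs
begin

text \<open>
  Summation by parts turns \<open>\<Sum>n. H\<^sub>n ^ j * (1 / n powr s - 1 / (n + 1) powr s)\<close> into a combination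
  of the series \<open>\<H>\<^sup>i (s + j - i)\<close> with \<open>i < j\<close>. Expanding \<open>(1 + 1 / n) powr (- s)\<close> in powers of
  \<open>1 / n\<close> instead expresses the same sum through \<open>\<H>\<^sup>j (s + 1), \<H>\<^sup>j (s + 2), \<dots>\<close> and a remainder that is
  holomorphic far to the left. Comparing the two continues \<open>\<H>\<^sup>j\<close> one unit to the left at a time,
  by induction on \<open>j\<close>.

  For \<open>j = m + 1\<close> and \<open>s = t \<rightarrow> 0\<close> through positive reals, the combination is
  \<open>(m + 1) * \<H>\<^sup>m (1 + t)\<close> plus terms that are regular at \<open>t = 0\<close>, whereas \<open>H\<^sub>n = ln n + \<gamma> + O(1 / n)\<close>
  shows that the sum differs by \<open>O(t)\<close> from \<open>t * \<integral>x\<ge>1. (ln x + \<gamma>) ^ (m + 1) / x powr (t + 1)\<close>. This is a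
  polynomial in \<open>1 / t\<close> with constant term \<open>\<gamma> ^ (m + 1)\<close>, and the formula follows by comparing
  constant terms.
\<close>

subsection \<open>Series with harmonic number coefficients\<close>

definition harm_series :: "nat \<Rightarrow> complex \<Rightarrow> complex" where
  "harm_series j s = (\<Sum>n. harm (Suc n) ^ j / of_nat (Suc n) powr s)"

lemma harm_le_ln: "harm (Suc n) \<le> 1 + ln (real (Suc n))"
  using euler_mascheroni_sequence_decreasing[of 1 "Suc n"] by (simp add: harm_expand)

text \<open>Since \<open>H_n\<close> is at most \<open>1 + ln n\<close>, each of its powers grows
  more slowly than any positive power of \<open>n\<close>. The convergence arguments below therefore
  treat \<open>H_n ^ j\<close> as a factor \<open>n powr \<epsilon>\<close>.\<close>

lemma norm_harm_power_bound:
  assumes "\<epsilon> > 0"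
  obtains C where "C > 0" "\<And>n. norm ((harm (Suc n) :: complex) ^ j) \<le> C * real (Suc n) powr \<epsilon>"
proof -
  \<comment> \<open>Dividing by \<open>j + 1\<close> gives \<open>e * j \<le> \<epsilon>\<close> and
    keeps \<open>e\<close> positive for \<open>j = 0\<close> too.\<close>
  define e where "e = \<epsilon> / (j + 1)"
  have e: "e > 0" using assms by (simp add: e_def)
  have "norm ((harm (Suc n) :: complex) ^ j) \<le> (1 + 1 / e) ^ j * real (Suc n) powr \<epsilon>" for n
  proof -
    have "ln (real (Suc n)) \<le> real (Suc n) powr e / e"
      using e by (intro ln_powr_bound) auto
    moreover have ge1: "1 \<le> real (Suc n) powr e"
      using e by (intro ge_one_powr_ge_zero) auto
    ultimately have "harm (Suc n) \<le> (1 + 1 / e) * real (Suc n) powr e"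
      using harm_le_ln[of n] by (simp add: algebra_simps)
    hence "harm (Suc n) ^ j \<le> ((1 + 1 / e) * real (Suc n) powr e) ^ j"
      by (intro power_mono harm_nonneg)
    also have "\<dots> = (1 + 1 / e) ^ j * real (Suc n) powr (e * j)"
      by (simp add: power_mult_distrib powr_powr[symmetric] powr_realpow)
    also have "\<dots> \<le> (1 + 1 / e) ^ j * real (Suc n) powr \<epsilon>"
      using e assms by (intro mult_left_mono powr_mono) (auto simp: e_def field_simps)
    finally show ?thesis
      by (simp add: norm_power norm_harm)
  qed
  thus ?thesis using e by (intro that[of "(1 + 1 / e) ^ j"]) (auto intro!: zero_less_power add_pos_pos)
qed

section \<open>Locally uniform convergence of series weighted by powers of harmonic numbers\<close>

lemma holomorphic_on_suminf:
  fixes f :: "nat \<Rightarrow> complex \<Rightarrow> complex"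
  assumes "open S" and hol: "\<And>n. f n holomorphic_on S"
    and bd: "\<And>x. x \<in> S \<Longrightarrow> \<exists>d>0. \<exists>M. cball x d \<subseteq> S \<and> summable M \<and> (\<forall>n. \<forall>y\<in>cball x d. norm (f n y) \<le> M n)"
  shows "(\<lambda>s. \<Sum>n. f n s) holomorphic_on S"
proof (rule holomorphic_uniform_sequence[where f = "\<lambda>N s. \<Sum>n<N. f n s"])
  fix x assume "x \<in> S"
  from bd[OF this] obtain d M where *: "d > 0" "cball x d \<subseteq> S" "summable M"
    "\<And>n y. y \<in> cball x d \<Longrightarrow> norm (f n y) \<le> M n" by blast
  thus "\<exists>d>0. cball x d \<subseteq> S \<and> uniform_limit (cball x d) (\<lambda>N s. \<Sum>n<N. f n s) (\<lambda>s. \<Sum>n. f n s) sequentially"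
    by (intro exI[of _ d] conjI Weierstrass_m_test[of _ _ M]) auto
qed (use assms in \<open>auto intro!: holomorphic_intros\<close>)

text \<open>On the ball the exponent of \<open>Suc n\<close> lies below -1 by a margin of at least
  \<open>d\<close>. The harmonic power uses up \<open>d/2\<close> of it, and the other half leaves a
  convergent majorant. The bound is used with \<open>\<sigma> = 1\<close> for the Dirichlet terms
  and with \<open>\<sigma> = - real N\<close> for the binomial remainders, whose constant
  \<open>B\<close> depends on \<open>R\<close>.\<close>

lemma harm_series_bound:
  fixes g :: "nat \<Rightarrow> complex \<Rightarrow> complex"
  assumes bd: "\<And>R. \<exists>B. \<forall>n s. norm s \<le> R \<longrightarrow> \<sigma> < Re s \<longrightarrow> norm (g n s) \<le> B * real (Suc n) powr (\<sigma> - 1 - Re s)"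
    and x: "\<sigma> < Re x"
  shows "\<exists>d>0. \<exists>M. cball x d \<subseteq> {s. \<sigma> < Re s} \<and> summable M \<and>
           (\<forall>n. \<forall>y\<in>cball x d. norm (harm (Suc n) ^ j * g n y) \<le> M n)"
proof -
  define d where "d = (Re x - \<sigma>) / 2"
  have d: "d > 0" using x by (simp add: d_def)
  have re: "Re y \<ge> \<sigma> + d" if "y \<in> cball x d" for y
    using that abs_Re_le_cmod[of "x - y"] by (auto simp: dist_norm d_def field_simps)
  obtain B where B: "\<And>n s. norm s \<le> norm x + d \<Longrightarrow> \<sigma> < Re s \<Longrightarrow> norm (g n s) \<le> B * real (Suc n) powr (\<sigma> - 1 - Re s)"
    using bd[of "norm x + d"] by blast
  obtain C where C: "C > 0" "\<And>n. norm ((harm (Suc n) :: complex) ^ j) \<le> C * real (Suc n) powr (d/2)"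
    using norm_harm_power_bound[of "d/2" j] d by auto
  define M where "M n = C * \<bar>B\<bar> * real (Suc n) powr (-1 - d/2)" for n
  have "summable M"
    unfolding M_def using d summable_real_powr_iff[of "-1 - d/2"]
    by (subst summable_Suc_iff[of "\<lambda>n. C * \<bar>B\<bar> * real n powr (-1 - d/2)"]) (intro summable_mult, simp)
  moreover have "norm (harm (Suc n) ^ j * g n y) \<le> M n" if y: "y \<in> cball x d" for n y
  proof -
    have "norm y \<le> norm x + d"
      using y norm_triangle_ineq2[of y x] by (auto simp: dist_norm norm_minus_commute)
    hence "norm (g n y) \<le> B * real (Suc n) powr (\<sigma> - 1 - Re y)"
      using B[of y n] re[OF y] d by auto
    also have "\<dots> \<le> \<bar>B\<bar> * real (Suc n) powr (-1 - d)"
      using re[OF y] by (intro mult_mono powr_mono) auto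
    finally have "norm (harm (Suc n) ^ j * g n y) \<le> (C * real (Suc n) powr (d/2)) * (\<bar>B\<bar> * real (Suc n) powr (-1 - d))"
      unfolding norm_mult using C by (intro mult_mono) auto
    also have "\<dots> = M n"
      by (simp add: M_def powr_add[symmetric] minus_diff_commute)
    finally show ?thesis .
  qed
  ultimately show ?thesis
    using d re by (intro exI[of _ d] conjI exI[of _ M]) (auto simp: subset_iff dest!: re[simplified])
qed

lemma harm_series_summable:
  fixes g :: "nat \<Rightarrow> complex \<Rightarrow> complex"
  assumes "\<And>R. \<exists>B. \<forall>n s. norm s \<le> R \<longrightarrow> \<sigma> < Re s \<longrightarrow> norm (g n s) \<le> B * real (Suc n) powr (\<sigma> - 1 - Re s)"
    and "\<sigma> < Re x"
  shows "summable (\<lambda>n. harm (Suc n) ^ j * g n x)"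
proof -
  have "\<exists>d>0. \<exists>M. cball x d \<subseteq> {s. \<sigma> < Re s} \<and> summable M \<and>
          (\<forall>n. \<forall>y\<in>cball x d. norm (harm (Suc n) ^ j * g n y) \<le> M n)"
    using assms by (rule harm_series_bound)
  then obtain d M where "d > 0" "summable M"
    and *: "\<forall>n. \<forall>y\<in>cball x d. norm (harm (Suc n) ^ j * g n y) \<le> M n"
    by (elim exE conjE)
  thus ?thesis
    by (intro summable_comparison_test'[OF \<open>summable M\<close>, of 0]) simp
qed

lemma harm_series_holomorphic:
  fixes g :: "nat \<Rightarrow> complex \<Rightarrow> complex"
  assumes "\<And>R. \<exists>B. \<forall>n s. norm s \<le> R \<longrightarrow> \<sigma> < Re s \<longrightarrow> norm (g n s) \<le> B * real (Suc n) powr (\<sigma> - 1 - Re s)"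
    and "\<And>n. g n holomorphic_on {s. \<sigma> < Re s}"
  shows "(\<lambda>s. \<Sum>n. harm (Suc n) ^ j * g n s) holomorphic_on {s. \<sigma> < Re s}"
proof (rule holomorphic_on_suminf)
  show "\<exists>d>0. \<exists>M. cball x d \<subseteq> {s. \<sigma> < Re s} \<and> summable M \<and>
          (\<forall>n. \<forall>y\<in>cball x d. norm (harm (Suc n) ^ j * g n y) \<le> M n)"
    if "x \<in> {s. \<sigma> < Re s}" for x
    using assms(1) that[unfolded mem_Collect_eq] by (rule harm_series_bound)
  show "(\<lambda>s. harm (Suc n) ^ j * g n s) holomorphic_on {s. \<sigma> < Re s}" for n
    by (intro holomorphic_intros assms)
qed (simp add: open_halfspace_Re_gt)

section \<open>The Dirichlet series of powers of harmonic numbers\<close>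

lemma norm_Suc_powr [simp]: "norm (of_nat (Suc n) powr s :: complex) = real (Suc n) powr Re s"
  using norm_powr_real_powr[of "of_nat (Suc n)" s] by (simp del: of_nat_Suc)

lemma dirichlet_term_bound:
  "\<exists>B. \<forall>n s. norm s \<le> R \<longrightarrow> 1 < Re s \<longrightarrow> norm (1 / of_nat (Suc n) powr s :: complex) \<le> B * real (Suc n) powr (1 - 1 - Re s)"
  by (rule exI[of _ 1]) (auto simp: norm_divide powr_minus field_simps simp del: of_nat_Suc)

lemma harm_series_sums:
  assumes "Re s > 1"
  shows "(\<lambda>n. harm (Suc n) ^ j / of_nat (Suc n) powr s) sums harm_series j s"
  using harm_series_summable[OF dirichlet_term_bound assms, of j]
  by (simp add: harm_series_def summable_sums)

lemma holomorphic_harm_series: "harm_series j holomorphic_on {s. Re s > 1}"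
proof -
  have "(\<lambda>s. \<Sum>n. harm (Suc n) ^ j * (1 / of_nat (Suc n) powr s)) holomorphic_on {s. 1 < Re s}"
    by (intro harm_series_holomorphic dirichlet_term_bound holomorphic_intros)
       (auto simp del: of_nat_Suc simp: powr_def)
  thus ?thesis by (simp add: harm_series_def[abs_def])
qed

subsection \<open>The recurrence\<close>

text \<open>Summation by parts moves the difference onto the harmonic powers. As
  \<open>harm n = harm (Suc n) - 1 / Suc n\<close>, the increment
  \<open>harm (Suc n) ^ j - harm n ^ j\<close> is a binomial sum in which the term
  \<open>i = j\<close> cancels. Each factor \<open>1 / Suc n\<close> raises the argument by one,
  hence the shift \<open>j - i\<close>.\<close>

lemma Dirichlet_difference_sums:
  assumes s: "Re s > 0"
  shows "(\<lambda>n. harm (Suc n) ^ j * (1 / of_nat (Suc n) powr s - 1 / of_nat (Suc (Suc n)) powr s)) sums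
           (0 ^ j + (\<Sum>i<j. - (of_nat (j choose i) * (-1) ^ (j - i)) * harm_series i (s + of_nat (j - i))))"
proof -
  \<comment> \<open>\<open>harm n\<close> is paired with the denominator of the next index; with
    this offset, \<open>u n - u (Suc n)\<close> plus the increment of the harmonic powers is the
    required summand.\<close>
  define u :: "nat \<Rightarrow> complex" where "u n = harm n ^ j / of_nat (Suc n) powr s" for n
  have "u \<longlonglongrightarrow> 0"
  proof -
    obtain C where C: "C > 0" "\<And>n. norm ((harm (Suc n) :: complex) ^ j) \<le> C * real (Suc n) powr (Re s / 2)"
      using norm_harm_power_bound[of "Re s / 2" j] s by auto
    have "norm (u n) \<le> C * real (Suc n) powr (- (Re s / 2))" for n
    proof -
      have "norm ((harm n :: complex) ^ j) \<le> norm ((harm (Suc n) :: complex) ^ j)"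
        unfolding norm_power norm_harm by (intro power_mono harm_mono harm_nonneg) auto
      also have "\<dots> \<le> C * real (Suc n) powr (Re s / 2)"
        by (rule C)
      finally have "norm (u n) \<le> C * real (Suc n) powr (Re s / 2) / real (Suc n) powr Re s"
        unfolding u_def norm_divide norm_Suc_powr by (intro divide_right_mono) auto
      also have "\<dots> = C * real (Suc n) powr (- (Re s / 2))"
      proof -
        have "real (Suc n) powr (Re s / 2) / real (Suc n) powr Re s = real (Suc n) powr (- (Re s / 2))"
          unfolding powr_diff[symmetric] by simp
        thus ?thesis by (metis times_divide_eq_right)
      qed
      finally show ?thesis .
    qed
    moreover have "(\<lambda>n. C * real (Suc n) powr (- (Re s / 2))) \<longlonglongrightarrow> C * 0"
      using s by (intro tendsto_mult tendsto_const tendsto_neg_powr filterlim_compose[OF filterlim_real_sequentially filterlim_Suc]) auto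
    ultimately show ?thesis
      by (intro Lim_null_comparison[of u "\<lambda>n. C * real (Suc n) powr (- (Re s / 2))"]) auto
  qed
  hence "(\<lambda>n. u n - u (Suc n)) sums (u 0 - 0)"
    by (rule telescope_sums')
  \<comment> \<open>\<open>harm 0 = 0\<close>, so with \<open>0 ^ 0 = 1\<close> the boundary term
    survives only for \<open>j = 0\<close>.\<close>
  moreover have "u 0 = 0 ^ j"
    by (simp add: u_def harm_expand)
  moreover have "(\<lambda>n. (harm (Suc n) ^ j - harm n ^ j) / of_nat (Suc n) powr s) sums
      (\<Sum>i<j. - (of_nat (j choose i) * (-1) ^ (j - i)) * harm_series i (s + of_nat (j - i)))"
  proof -
    have "(\<lambda>n. \<Sum>i<j. - (of_nat (j choose i) * (-1) ^ (j - i)) *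
              (harm (Suc n) ^ i / of_nat (Suc n) powr (s + of_nat (j - i)))) sums
          (\<Sum>i<j. - (of_nat (j choose i) * (-1) ^ (j - i)) * harm_series i (s + of_nat (j - i)))"
      using s by (intro sums_sum sums_mult harm_series_sums) auto
    also have "(\<lambda>n. \<Sum>i<j. - (of_nat (j choose i) * (-1) ^ (j - i)) *
              (harm (Suc n) ^ i / of_nat (Suc n) powr (s + of_nat (j - i)))) =
        (\<lambda>n. (harm (Suc n) ^ j - harm n ^ j) / of_nat (Suc n) powr s)"
    proof
      fix n
      define m :: complex where "m = of_nat (Suc n)"
      define h :: complex where "h = harm (Suc n)"
      have m: "m \<noteq> 0" unfolding m_def by (simp del: of_nat_Suc)
      have "harm n = h + (- inverse m)"
        by (simp add: h_def m_def harm_Suc)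
      hence "harm n ^ j = (\<Sum>i\<le>j. of_nat (j choose i) * h ^ i * (- inverse m) ^ (j - i))"
        by (simp only: binomial_ring)
      also have "\<dots> = h ^ j + (\<Sum>i<j. of_nat (j choose i) * h ^ i * (- inverse m) ^ (j - i))"
        by (simp add: lessThan_Suc_atMost[symmetric])
      finally have *: "h ^ j - harm n ^ j = - (\<Sum>i<j. of_nat (j choose i) * h ^ i * (- inverse m) ^ (j - i))"
        by simp
      have Q: "(- inverse m) ^ k / m powr s = (-1) ^ k / m powr (s + of_nat k)" for k
        using m by (subst power_minus) (simp add: powr_add powr_nat' power_inverse field_simps)
      have "(of_nat (j choose i) * h ^ i * (- inverse m) ^ (j - i)) / m powr s =
              of_nat (j choose i) * (-1) ^ (j - i) * (h ^ i / m powr (s + of_nat (j - i)))" for i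
        unfolding times_divide_eq_right[symmetric] Q by simp
      hence "(h ^ j - harm n ^ j) / m powr s = (\<Sum>i<j. - (of_nat (j choose i) * (-1) ^ (j - i)) *
              (h ^ i / m powr (s + of_nat (j - i))))"
        unfolding * by (simp add: sum_divide_distrib sum_negf)
      thus "(\<Sum>i<j. - (of_nat (j choose i) * (-1) ^ (j - i)) *
              (harm (Suc n) ^ i / of_nat (Suc n) powr (s + of_nat (j - i)))) =
            (harm (Suc n) ^ j - harm n ^ j) / of_nat (Suc n) powr s"
        by (simp only: h_def m_def)
    qed
    finally show ?thesis .
  qed
  ultimately have "(\<lambda>n. (u n - u (Suc n)) + (harm (Suc n) ^ j - harm n ^ j) / of_nat (Suc n) powr s) sums
      (0 ^ j + (\<Sum>i<j. - (of_nat (j choose i) * (-1) ^ (j - i)) * harm_series i (s + of_nat (j - i))))"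
    using sums_add by fastforce
  moreover have "(u n - u (Suc n)) + (harm (Suc n) ^ j - harm n ^ j) / of_nat (Suc n) powr s =
      harm (Suc n) ^ j * (1 / of_nat (Suc n) powr s - 1 / of_nat (Suc (Suc n)) powr s)" for n
    by (simp add: u_def algebra_simps diff_divide_distrib del: of_nat_Suc)
  ultimately show ?thesis
    by simp
qed

section \<open>Binomial expansion of the shifted Dirichlet terms\<close>

lemma norm_pochhammer_le:
  fixes s :: complex
  assumes "norm s \<le> R"
  shows "norm (pochhammer s n) \<le> pochhammer R n"
proof -
  have "norm (s + of_nat i) \<le> R + real i" for i
    using assms norm_triangle_ineq[of s "of_nat i"] by simp
  hence "norm (\<Prod>i = 0..<n. s + of_nat i) \<le> (\<Prod>i = 0..<n. R + of_nat i)"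
    by (subst prod_norm[symmetric], intro prod_mono) auto
  thus ?thesis
    by (simp add: pochhammer_prod)
qed

text \<open>Taylor's theorem for \<open>(1 + z) powr (-s)\<close> on the segment from 0 to 1, where
  \<open>1 + z\<close> stays off the branch cut. The constant depends on \<open>s\<close> only
  through \<open>R\<close>, which gives control that is locally uniform in \<open>s\<close>.\<close>

lemma binomial_Taylor_bound:
  fixes s :: complex
  assumes s: "norm s \<le> R" and x: "0 \<le> x" "x \<le> 1"
  shows "norm ((1 + of_real x) powr (-s) - (\<Sum>i\<le>N. (-1) ^ i * pochhammer s i / fact i * of_real x ^ i))
           \<le> pochhammer R (Suc N) * 2 powr R / fact N * x ^ Suc N"
proof -
  \<comment> \<open>\<open>f i\<close> is the \<open>i\<close>-th derivative of
    \<open>f 0\<close>.\<close>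
  define f where "f i z = (-1) ^ i * pochhammer s i * (1 + z) powr (- s - of_nat i)" for i z
  define S where "S = closed_segment (0::complex) 1"
  have S: "\<exists>t\<in>{0..1}. z = of_real t" if "z \<in> S" for z
    using that by (auto simp: S_def closed_segment_def scaleR_conv_of_real)
  have R: "R \<ge> 0" using s norm_ge_zero order_trans by blast
  have "norm (f 0 (of_real x) - (\<Sum>i\<le>N. f i 0 * (of_real x - 0) ^ i / fact i))
          \<le> (pochhammer R (Suc N) * 2 powr R) * norm (of_real x - 0 :: complex) ^ Suc N / fact N"
  proof (rule complex_Taylor[where S = S and f = f])
    fix i z assume "z \<in> S"
    then obtain t where t: "t \<in> {0..1}" "z = of_real t" using S by blast
    have "1 + z \<notin> \<real>\<^sub>\<le>\<^sub>0"
      using t by (auto simp: complex_nonpos_Reals_iff)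
    thus "(f i has_field_derivative f (Suc i) z) (at z within S)"
      unfolding f_def
      by (auto intro!: derivative_eq_intros simp: pochhammer_Suc algebra_simps)
  next
    fix z assume "z \<in> S"
    then obtain t where t: "t \<in> {0..1}" "z = of_real t" using S by blast
    have "norm ((1 + z) powr (- s - of_nat (Suc N))) = (1 + t) powr (- Re s - of_nat (Suc N))"
      using t norm_powr_real_powr[of "1 + z" "- s - of_nat (Suc N)"] by simp
    also have "\<dots> \<le> (1 + t) powr R"
      using t s R abs_Re_le_cmod[of s] by (intro powr_mono) auto
    also have "\<dots> \<le> 2 powr R"
      using t R by (intro powr_mono2) auto
    finally show "norm (f (Suc N) z) \<le> pochhammer R (Suc N) * 2 powr R"
      unfolding f_def norm_mult using norm_pochhammer_le[OF s, of "Suc N"]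
      by (intro mult_mono) (auto simp: norm_power intro: order_trans[OF norm_ge_zero])
  next
    show "convex S" by (simp add: S_def)
  qed (use x in \<open>auto simp: S_def closed_segment_def scaleR_conv_of_real\<close>)
  thus ?thesis
    using x by (simp add: f_def mult_ac divide_simps)
qed

text \<open>The error of expanding \<open>(1 + 1 / Suc n) powr (-s)\<close> to order
  \<open>N\<close> in \<open>1 / Suc n\<close>, multiplied by \<open>Suc n powr (-s)\<close>. The
  factor \<open>(1 / Suc n) ^ i\<close> is absorbed into the argument \<open>s + i\<close>.\<close>

definition Dirichlet_remainder :: "nat \<Rightarrow> nat \<Rightarrow> complex \<Rightarrow> complex" where
  "Dirichlet_remainder N n s =
     1 / of_nat (Suc (Suc n)) powr s -
     (\<Sum>i\<le>N. (-1) ^ i * pochhammer s i / fact i * (1 / of_nat (Suc n) powr (s + of_nat i)))"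

text \<open>After \<open>1 / Suc n powr s\<close> is factored out, the Taylor bound at
  \<open>x = 1 / Suc n\<close> gains \<open>N + 1\<close> powers of decay. This is why the
  remainders are summable, even with harmonic weights, as far left as
  \<open>Re s > - N\<close>.\<close>

lemma Dirichlet_remainder_bound:
  "\<exists>B. \<forall>n s. norm s \<le> R \<longrightarrow> - real N < Re s \<longrightarrow>
         norm (Dirichlet_remainder N n s) \<le> B * real (Suc n) powr (- real N - 1 - Re s)"
proof (intro exI allI impI)
  fix n :: nat and s :: complex
  assume s: "norm s \<le> R"
  define x where "x = 1 / real (Suc n)"
  define m :: complex where "m = of_nat (Suc n)"
  have m: "m \<noteq> 0" "m = of_real (real (Suc n))" "m * (1 + of_real x) = of_nat (Suc (Suc n))"
    unfolding m_def x_def by (simp_all add: field_simps flip: of_nat_Suc)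
  have mx: "of_real x = 1 / m" by (simp add: x_def m_def)
  have "Dirichlet_remainder N n s = 1 / m powr s * ((1 + of_real x) powr (-s) -
          (\<Sum>i\<le>N. (-1) ^ i * pochhammer s i / fact i * of_real x ^ i))"
  proof -
    \<comment> \<open>The power of the product splits because both factors are positive
      reals.\<close>
    have "(m * (1 + of_real x)) powr s = m powr s * (1 + of_real x) powr s"
      unfolding m(2) using powr_times_real[of "of_real (real (Suc n))" "1 + of_real x" s]
      by (simp add: x_def del: of_nat_Suc)
    hence "1 / of_nat (Suc (Suc n)) powr s = 1 / m powr s * (1 + of_real x) powr (-s)"
      using m by (simp add: powr_minus field_simps)
    moreover have "1 / m powr (s + of_nat i) = 1 / m powr s * of_real x ^ i" for i
      using m(1) by (simp add: mx powr_add powr_nat' power_divide field_simps)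
    ultimately show ?thesis
      unfolding Dirichlet_remainder_def m_def[symmetric]
      by (simp add: right_diff_distrib sum_distrib_left mult_ac)
  qed
  also have "norm \<dots> \<le> 1 / real (Suc n) powr Re s * (pochhammer R (Suc N) * 2 powr R / fact N * x ^ Suc N)"
    unfolding norm_mult norm_divide m_def norm_Suc_powr norm_one
    by (intro mult_left_mono binomial_Taylor_bound s) (auto simp: x_def)
  also have "x ^ Suc N = real (Suc n) powr (- real (Suc N))"
    unfolding x_def powr_minus by (subst powr_realpow) (auto simp: power_divide field_simps)
  also have "1 / real (Suc n) powr Re s * (pochhammer R (Suc N) * 2 powr R / fact N * real (Suc n) powr (- real (Suc N)))
      = (pochhammer R (Suc N) * 2 powr R / fact N) * real (Suc n) powr (- real N - 1 - Re s)"
    by (simp add: powr_diff powr_minus powr_add field_simps del: of_nat_Suc) (simp add: powr_add)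
  finally show "norm (Dirichlet_remainder N n s) \<le>
      (pochhammer R (Suc N) * 2 powr R / fact N) * real (Suc n) powr (- real N - 1 - Re s)" .
qed

definition remainder_series :: "nat \<Rightarrow> nat \<Rightarrow> complex \<Rightarrow> complex" where
  "remainder_series N j s = (\<Sum>n. harm (Suc n) ^ j * Dirichlet_remainder N n s)"

lemma holomorphic_remainder_series: "remainder_series N j holomorphic_on {s. - real N < Re s}"
  unfolding remainder_series_def
proof (rule harm_series_holomorphic[OF Dirichlet_remainder_bound])
  show "Dirichlet_remainder N n holomorphic_on {s. - real N < Re s}" for n
    unfolding Dirichlet_remainder_def by (intro holomorphic_intros) (auto simp del: of_nat_Suc simp: powr_def)
qed

text \<open>Two evaluations of one sum at \<open>t = s - 1\<close> are equated: summation by parts,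
  and the binomial expansion with its remainder. On the right, index \<open>j\<close> occurs only at
  arguments at least one unit to the right of \<open>s\<close>, and each \<open>i < j\<close> only
  at arguments not to the left of \<open>s\<close>. The identity thus serves as a rule for
  continuing \<open>harm_series j\<close>.\<close>

lemma harm_series_recurrence:
  assumes s: "Re s > 1"
  shows "(s - 1) * harm_series j s =
    0 ^ j + (\<Sum>i<j. - (of_nat (j choose i) * (-1) ^ (j - i)) * harm_series i (s - 1 + of_nat (j - i)))
    + (\<Sum>i\<in>{2..Suc N}. (-1) ^ i * pochhammer (s - 1) i / fact i * harm_series j (s - 1 + of_nat i))
    + remainder_series (Suc N) j (s - 1)"
proof -
  define t where "t = s - 1"
  have t: "Re t > 0" using s by (simp add: t_def)
  define c :: "nat \<Rightarrow> complex" where "c i = (-1) ^ i * pochhammer t i / fact i" for i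
  have rem: "(\<lambda>n. harm (Suc n) ^ j * Dirichlet_remainder (Suc N) n t) sums remainder_series (Suc N) j t"
    unfolding remainder_series_def
    by (rule summable_sums, rule harm_series_summable[OF Dirichlet_remainder_bound]) (use t in auto)
  have main: "(\<lambda>n. \<Sum>i\<in>{1..Suc N}. c i * (harm (Suc n) ^ j / of_nat (Suc n) powr (t + of_nat i))) sums
          (\<Sum>i\<in>{1..Suc N}. c i * harm_series j (t + of_nat i))"
    using t by (intro sums_sum sums_mult harm_series_sums) auto
  have split0: "{..Suc N} = insert 0 {1..Suc N}" by auto
  have D: "Dirichlet_remainder (Suc N) n t = 1 / of_nat (Suc (Suc n)) powr t - 1 / of_nat (Suc n) powr t
     - (\<Sum>i\<in>{1..Suc N}. c i * (1 / of_nat (Suc n) powr (t + of_nat i)))" for n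
    unfolding Dirichlet_remainder_def split0 c_def by (simp del: of_nat_Suc sum.cl_ivl_Suc)
  have "harm (Suc n) ^ j * (1 / of_nat (Suc n) powr t - 1 / of_nat (Suc (Suc n)) powr t) =
    - (harm (Suc n) ^ j * Dirichlet_remainder (Suc N) n t +
       (\<Sum>i\<in>{1..Suc N}. c i * (harm (Suc n) ^ j / of_nat (Suc n) powr (t + of_nat i))))" for n
    by (simp add: D algebra_simps sum_distrib_left del: of_nat_Suc sum.cl_ivl_Suc)
  with sums_minus[OF sums_add[OF rem main]]
  have "(\<lambda>n. harm (Suc n) ^ j * (1 / of_nat (Suc n) powr t - 1 / of_nat (Suc (Suc n)) powr t)) sums
     (- (remainder_series (Suc N) j t + (\<Sum>i\<in>{1..Suc N}. c i * harm_series j (t + of_nat i))))"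
    by presburger
  from sums_unique2[OF this Dirichlet_difference_sums[OF t]]
  have "0 ^ j + (\<Sum>i<j. - (of_nat (j choose i) * (-1) ^ (j - i)) * harm_series i (t + of_nat (j - i))) =
     - (remainder_series (Suc N) j t + (\<Sum>i\<in>{1..Suc N}. c i * harm_series j (t + of_nat i)))" ..
  \<comment> \<open>The term \<open>i = 1\<close> is \<open>- t * harm_series j (t + 1)\<close>, and
    \<open>t + 1 = s\<close>; it is split off as the unknown.\<close>
  moreover have "{1..Suc N} = insert 1 {2..Suc N}" by auto
  hence "(\<Sum>i\<in>{1..Suc N}. c i * harm_series j (t + of_nat i)) =
      - t * harm_series j (t + 1) + (\<Sum>i\<in>{2..Suc N}. c i * harm_series j (t + of_nat i))"
    by (simp add: c_def del: sum.cl_ivl_Suc)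
  moreover have "t * H = Z + A + Q + E" if "Z + A = - (E + P)" "P = - t * H + Q" for H Z A Q E P
    using that by algebra
  ultimately have "t * harm_series j (t + 1) =
    0 ^ j + (\<Sum>i<j. - (of_nat (j choose i) * (-1) ^ (j - i)) * harm_series i (t + of_nat (j - i)))
    + (\<Sum>i\<in>{2..Suc N}. c i * harm_series j (t + of_nat i))
    + remainder_series (Suc N) j t"
    by blast
  thus ?thesis
    by (simp add: t_def c_def)
qed

subsection \<open>Meromorphic continuation\<close>

text \<open>The difference vanishes on the open set \<open>U\<close>, hence off a sparse set by the
  identity theorem. Niceness upgrades this to equality at each point: the value is 0 at a pole and
  the limit elsewhere, and both are determined by nearby values.\<close>

lemma nicely_meromorphic_on_eqI:
  assumes F: "F nicely_meromorphic_on A" and G: "G nicely_meromorphic_on A"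
    and A: "open A" "connected A"
    and U: "open U" "U \<subseteq> A" "U \<noteq> {}" "\<And>z. z \<in> U \<Longrightarrow> F z = G z"
    and z: "z \<in> A"
  shows "F z = G z"
proof -
  have "(\<lambda>z. F z - G z) meromorphic_on A"
    using F G by (intro meromorphic_intros) (auto simp: nicely_meromorphic_on_def)
  hence "eventually (\<lambda>z. F z - G z = 0) (cosparse A) \<or> eventually (\<lambda>z. F z - G z \<noteq> 0) (cosparse A)"
    using A by (rule meromorphic_imp_constant_or_avoid)
  moreover have "\<not>eventually (\<lambda>z. F z - G z \<noteq> 0) (cosparse A)"
  proof
    assume *: "eventually (\<lambda>z. F z - G z \<noteq> 0) (cosparse A)"
    obtain u where u: "u \<in> U" using U by auto
    with * have "eventually (\<lambda>z. F z - G z \<noteq> 0) (at u)"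
      using U by (auto simp: eventually_cosparse_open_eq A)
    moreover have "eventually (\<lambda>z. z \<in> U) (at u)"
      using u U by (intro eventually_at_in_open') auto
    ultimately have "eventually (\<lambda>_. False) (at u)"
      by eventually_elim (use U in auto)
    thus False by simp
  qed
  ultimately have "eventually (\<lambda>z. F z - G z = 0) (cosparse A)"
    by blast
  hence ev: "eventually (\<lambda>w. F w = G w) (at z)"
    using z by (simp add: eventually_cosparse_open_eq A)
  show ?thesis
  proof (cases "is_pole F z")
    case True
    moreover have "is_pole G z"
      using True is_pole_cong[OF ev] by simp
    ultimately have "\<not>F \<midarrow>z\<rightarrow> F z" "\<not>G \<midarrow>z\<rightarrow> G z"
      using not_tendsto_and_filterlim_at_infinity[of "at z"] by (auto simp: is_pole_def)
    hence "F z = 0" "G z = 0"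
      using F G z unfolding nicely_meromorphic_on_def by blast+
    thus ?thesis
      by simp
  next
    case False
    moreover have "\<not>is_pole G z"
      using False is_pole_cong[OF ev] by simp
    ultimately have "F \<midarrow>z\<rightarrow> F z" "G \<midarrow>z\<rightarrow> G z"
      using F G z by (auto simp: nicely_meromorphic_on_def)
    moreover have "F \<midarrow>z\<rightarrow> F z \<longleftrightarrow> G \<midarrow>z\<rightarrow> F z"
      using ev by (rule tendsto_cong)
    ultimately show ?thesis
      using tendsto_unique[of "at z" G] by auto
  qed
qed

lemma nicely_meromorphic_on_cong:
  assumes "open A" "\<And>z. z \<in> A \<Longrightarrow> f z = g z" "f nicely_meromorphic_on A"
  shows "g nicely_meromorphic_on A"
proof -
  have ev: "eventually (\<lambda>w. f w = g w) (at z)" if "z \<in> A" for z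
    using eventually_at_in_open'[OF assms(1) that] by eventually_elim (use assms in auto)
  have "g meromorphic_on A"
    using assms(3) meromorphic_on_cong[of A f g A] ev by (auto simp: nicely_meromorphic_on_def)
  moreover have "is_pole g z \<and> g z = 0 \<or> g \<midarrow>z\<rightarrow> g z" if "z \<in> A" for z
    using assms that is_pole_cong[OF ev[OF that] refl] tendsto_cong[OF ev[OF that]]
    by (auto simp: nicely_meromorphic_on_def)
  ultimately show ?thesis
    by (simp add: nicely_meromorphic_on_def)
qed

text \<open>The continuations to the half-planes \<open>H K\<close> are normalised by
  \<open>remove_sings\<close>; they then agree on overlaps by the identity theorem and glue to a
  function on the plane.\<close>

lemma nicely_meromorphic_continuation_UNIV:
  assumes f: "f holomorphic_on {s. 1 < Re s}"
    and ex: "\<And>K::nat. \<exists>F. F meromorphic_on {s. 1 - real K < Re s} \<and> (\<forall>s. 1 < Re s \<longrightarrow> F s = f s)"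
  shows "\<exists>F. F nicely_meromorphic_on UNIV \<and> (\<forall>s. 1 < Re s \<longrightarrow> F s = f s)"
proof -
  define H where "H K = {s. 1 - real K < Re s}" for K :: nat
  have H: "open (H K)" "connected (H K)" for K
    unfolding H_def by (auto intro!: open_halfspace_Re_gt convex_connected convex_halfspace_Re_gt)
  have "\<exists>F. F nicely_meromorphic_on H K \<and> (\<forall>s. 1 < Re s \<longrightarrow> F s = f s)" for K
  proof -
    obtain F where F: "F meromorphic_on H K" "\<And>s. 1 < Re s \<Longrightarrow> F s = f s"
      using ex[of K] by (auto simp: H_def)
    \<comment> \<open>\<open>remove_sings\<close> keeps the value at points of analyticity, so the
      normalised function still equals \<open>f\<close> here.\<close>
    have "F holomorphic_on {s. 1 < Re s}"
      using f F(2) by (subst holomorphic_cong[of _ _ F f]) auto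
    hence "F analytic_on {s. 1 < Re s}"
      by (simp add: analytic_on_open open_halfspace_Re_gt)
    hence "F analytic_on {s}" if "1 < Re s" for s
      by (rule analytic_on_subset) (use that in auto)
    hence "remove_sings F s = f s" if "1 < Re s" for s
      using that F(2) by simp
    thus ?thesis
      using remove_sings_nicely_meromorphic[OF F(1)] by blast
  qed
  then obtain G where G: "\<And>K. G K nicely_meromorphic_on H K" "\<And>K s. 1 < Re s \<Longrightarrow> G K s = f s"
    by metis
  have mono: "G K s = G L s" if "K \<le> L" "s \<in> H K" for K L s
  proof (rule nicely_meromorphic_on_eqI[of "G K" "H K" "G L" "{s. 1 < Re s}" s])
    show "G L nicely_meromorphic_on H K"
      by (rule nicely_meromorphic_on_subset[OF G(1)[of L]]) (use that in \<open>auto simp: H_def\<close>)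
    have "complex_of_real 2 \<in> {s. 1 < Re s}" by simp
    thus "{s. 1 < Re s} \<noteq> {}" by blast
    show "{s. 1 < Re s} \<subseteq> H K"
      by (auto simp: H_def)
    show "G K w = G L w" if "w \<in> {s. 1 < Re s}" for w
      using that by (simp add: G(2))
  qed (use that H G(1) in \<open>simp_all add: open_halfspace_Re_gt\<close>)
  have agree: "G K s = G L s" if "s \<in> H K" "s \<in> H L" for K L s
    using that by (metis mono nat_le_linear)
  \<comment> \<open>Membership in \<open>H K\<close> asks for \<open>K > 1 - Re s\<close>; rounding
    up \<open>2 - Re s\<close> secures the strict inequality.\<close>
  define k where "k s = nat \<lceil>2 - Re s\<rceil>" for s
  have k: "s \<in> H (k s)" for s
    unfolding H_def k_def mem_Collect_eq by linarith
  define F where "F s = G (k s) s" for s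
  have FG: "F s = G K s" if "s \<in> H K" for K s
    using agree[OF k that] by (simp add: F_def)
  have "F nicely_meromorphic_on H K" for K
    using H(1) FG[symmetric] G(1) by (rule nicely_meromorphic_on_cong)
  hence "F nicely_meromorphic_on UNIV"
    using k unfolding nicely_meromorphic_on_def meromorphic_on_def by blast
  moreover have "F s = f s" if "1 < Re s" for s
    using G(2)[OF that] by (simp add: F_def)
  ultimately show ?thesis by blast
qed

lemma mero_cont:
  assumes "F nicely_meromorphic_on UNIV" "\<And>s. 1 < Re s \<Longrightarrow> F s = f s"
  shows "mero_cont f = F"
  unfolding mero_cont_def
proof (rule the_equality)
  fix G assume G: "G nicely_meromorphic_on UNIV \<and> (\<forall>s. 1 < Re s \<longrightarrow> G s = f s)"
  have "complex_of_real 2 \<in> {s. 1 < Re s}" by simp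
  hence ne: "{s::complex. 1 < Re s} \<noteq> {}" by blast
  have "G s = F s" for s
  proof (rule nicely_meromorphic_on_eqI[of G UNIV F "{s. 1 < Re s}"])
    show "G w = F w" if "w \<in> {s. 1 < Re s}" for w
      using that G assms(2)[of w] by simp
    show "G nicely_meromorphic_on UNIV"
      using G by blast
  qed (fact assms(1) ne | simp add: open_halfspace_Re_gt connected_UNIV)+
  thus "G = F" by blast
qed (use assms in auto)

text \<open>The outer induction is on \<open>j\<close>, the inner one on \<open>K\<close>.
  \<open>K\<close> is generalised in the outer one because the smaller indices are already needed on
  the next larger half-plane.\<close>

lemma harm_series_continuation:
  "\<exists>F. F meromorphic_on {s. 1 - real K < Re s} \<and> (\<forall>s. 1 < Re s \<longrightarrow> F s = harm_series j s)"
proof (induction j arbitrary: K rule: less_induct)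
  case (less j)
  show ?case
  proof (induction K)
    case 0
    have "harm_series j analytic_on {s. 1 < Re s}"
      using holomorphic_harm_series by (simp add: analytic_on_open open_halfspace_Re_gt)
    thus ?case
      by (intro exI[of _ "harm_series j"]) (auto intro: analytic_on_imp_meromorphic_on)
  next
    case (Suc K)
    then obtain F where F: "F meromorphic_on {s. 1 - real K < Re s}" "\<And>s. 1 < Re s \<Longrightarrow> F s = harm_series j s"
      by blast
    have "\<forall>i. \<exists>G. i < j \<longrightarrow> G meromorphic_on {s. 1 - real (Suc K) < Re s} \<and> (\<forall>s. 1 < Re s \<longrightarrow> G s = harm_series i s)"
      using less by blast
    then obtain G where G: "\<And>i. i < j \<Longrightarrow> G i meromorphic_on {s. 1 - real (Suc K) < Re s}"
      "\<And>i s. i < j \<Longrightarrow> 1 < Re s \<Longrightarrow> G i s = harm_series i s"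
      by metis
    \<comment> \<open>The recurrence solved for \<open>harm_series j s\<close>. Shifts by
      \<open>i - 1 \<ge> 1\<close> carry the new half-plane into the domain of \<open>F\<close>,
      shifts by \<open>j - i - 1 \<ge> 0\<close> keep it in the domain of \<open>G i\<close>, and
      order \<open>Suc K\<close> makes the remainder holomorphic on exactly this half-plane.\<close>
    define F' where "F' s = (0 ^ j + (\<Sum>i<j. - (of_nat (j choose i) * (-1) ^ (j - i)) * G i (s - 1 + of_nat (j - i)))
      + (\<Sum>i\<in>{2..Suc K}. (-1) ^ i * pochhammer (s - 1) i / fact i * F (s - 1 + of_nat i))
      + remainder_series (Suc K) j (s - 1)) / (s - 1)" for s
    let ?H = "{s. 1 - real (Suc K) < Re s}"
    have "(\<lambda>s. remainder_series (Suc K) j (s - 1)) holomorphic_on ?H"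
      by (rule holomorphic_on_compose_gen[OF _ holomorphic_remainder_series, unfolded o_def])
         (auto intro!: holomorphic_intros)
    hence R: "(\<lambda>s. remainder_series (Suc K) j (s - 1)) meromorphic_on ?H"
      by (intro analytic_on_imp_meromorphic_on) (simp add: analytic_on_open open_halfspace_Re_gt)
    have G': "(\<lambda>s. G i (s - 1 + of_nat (j - i))) meromorphic_on ?H" if "i < j" for i
      by (rule meromorphic_on_compose[OF G(1)[OF that]]) (use that in \<open>auto intro!: analytic_intros\<close>)
    have F'': "(\<lambda>s. F (s - 1 + of_nat i)) meromorphic_on ?H" if "i \<in> {2..Suc K}" for i
      by (rule meromorphic_on_compose[OF F(1)]) (use that in \<open>auto intro!: analytic_intros\<close>)
    have P: "(\<lambda>s. pochhammer (s - 1) i) meromorphic_on ?H" for i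
      unfolding pochhammer_prod by (intro meromorphic_intros)
    have "F' meromorphic_on ?H"
      unfolding F'_def by (intro meromorphic_intros R G' F'' P) auto
    moreover have "F' s = harm_series j s" if s: "1 < Re s" for s
    proof -
      have "G i (s - 1 + of_nat (j - i)) = harm_series i (s - 1 + of_nat (j - i))" if "i < j" for i
        using s that by (intro G) auto
      moreover have "F (s - 1 + of_nat i) = harm_series j (s - 1 + of_nat i)" if "i \<in> {2..Suc K}" for i
        using s that by (intro F) auto
      ultimately have "F' s = ((s - 1) * harm_series j s) / (s - 1)"
        unfolding F'_def harm_series_recurrence[OF s, of j K] by simp
      also have "s \<noteq> 1" using s by auto
      hence "((s - 1) * harm_series j s) / (s - 1) = harm_series j s" by simp
      finally show ?thesis .
    qed
    ultimately show ?case by blast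
  qed
qed

lemma harm_zeta:
  shows nicely_meromorphic_harm_zeta: "harm_zeta j nicely_meromorphic_on UNIV"
    and harm_zeta_eq_series: "1 < Re s \<Longrightarrow> harm_zeta j s = harm_series j s"
proof -
  obtain F where F: "F nicely_meromorphic_on UNIV" "\<And>s. 1 < Re s \<Longrightarrow> F s = harm_series j s"
    using nicely_meromorphic_continuation_UNIV[OF holomorphic_harm_series[of j] harm_series_continuation] by blast
  have "harm_zeta j = F"
    unfolding harm_zeta_def using F by (intro mero_cont) (auto simp: harm_series_def)
  with F show "harm_zeta j nicely_meromorphic_on UNIV" "1 < Re s \<Longrightarrow> harm_zeta j s = harm_series j s"
    by auto
qed

lemma riemann_zeta_eq_harm_zeta: "riemann_zeta = harm_zeta 0"
  by (simp add: riemann_zeta_def harm_zeta_def)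

subsection \<open>Asymptotics as \<open>t\<close> tends to 0\<close>

text \<open>Up to the allowed error, \<open>harm (Suc n) - euler_mascheroni\<close> and
  \<open>ln x\<close> both lie between \<open>ln (n + 1)\<close> and \<open>ln (n + 2)\<close>.
  Letting \<open>x\<close> range over the whole unit interval prepares a mean value estimate
  there.\<close>

lemma harm_ln_diff_bound:
  assumes x: "real (Suc n) \<le> x" "x \<le> real (Suc n) + 1"
  shows "\<bar>harm (Suc n) - (ln x + euler_mascheroni)\<bar> \<le> 1 / real (Suc n)"
proof -
  have "ln (real n + 2) - ln (real n + 1) = ln (1 + 1 / (real n + 1))"
    using ln_div[of "real n + 2" "real n + 1"] by (simp add: field_simps)
  also have "\<dots> \<le> 1 / (real n + 1)"
    by (rule ln_add_one_self_le_self) auto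
  finally have "ln (real n + 2) - ln (real n + 1) \<le> 1 / (real n + 1)" .
  moreover have "ln (real n + 1) \<le> ln x" "ln x \<le> ln (real n + 2)"
    using x by auto
  moreover have "harm (Suc n) \<le> euler_mascheroni + ln (real n + 2)"
  proof -
    have "harm (Suc n) \<le> euler_mascheroni + ln (real (n + 2)) - 1 / real (2 * (n + 2))"
      using euler_mascheroni_lower[of n] by linarith
    also have "\<dots> \<le> euler_mascheroni + ln (real (n + 2))"
      by simp
    finally show ?thesis by (simp add: add_ac)
  qed
  moreover have "euler_mascheroni + ln (real n + 2) \<le> harm (Suc n) + 1 / (real n + 1)"
  proof -
    have "euler_mascheroni + ln (real (n + 2)) \<le> harm (Suc n) + 1 / real (2 * (n + 1))"
      using euler_mascheroni_upper[of n] by linarith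
    also have "1 / real (2 * (n + 1)) \<le> 1 / (real n + 1)"
      by (simp add: field_simps)
    finally show ?thesis by (simp add: add_ac)
  qed
  ultimately show ?thesis
    by (simp add: algebra_simps abs_le_iff)
qed

text \<open>A Lipschitz bound for powers. The exponent \<open>M\<close> in place of the sharp
  \<open>M - 1\<close> avoids truncated subtraction, at the price of
  \<open>1 \<le> c\<close>.\<close>

lemma abs_power_diff_le:
  fixes a b c :: real
  assumes "\<bar>a\<bar> \<le> c" "\<bar>b\<bar> \<le> c" "1 \<le> c"
  shows "\<bar>a ^ M - b ^ M\<bar> \<le> real M * c ^ M * \<bar>a - b\<bar>"
proof (induction M)
  case (Suc M)
  have "\<bar>a ^ Suc M - b ^ Suc M\<bar> = \<bar>a * (a ^ M - b ^ M) + b ^ M * (a - b)\<bar>"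
    by (simp add: algebra_simps)
  also have "\<dots> \<le> \<bar>a\<bar> * \<bar>a ^ M - b ^ M\<bar> + \<bar>b\<bar> ^ M * \<bar>a - b\<bar>"
    by (rule order_trans[OF abs_triangle_ineq]) (simp add: abs_mult power_abs)
  also have "\<dots> \<le> c * (real M * c ^ M * \<bar>a - b\<bar>) + c ^ Suc M * \<bar>a - b\<bar>"
  proof (intro add_mono mult_mono Suc.IH)
    have "\<bar>b\<bar> ^ M \<le> c ^ M" using assms by (intro power_mono) auto
    also have "\<dots> \<le> c ^ Suc M" using assms by (intro power_increasing) auto
    finally show "\<bar>b\<bar> ^ M \<le> c ^ Suc M" .
  qed (use assms in auto)
  finally show ?case by (simp add: algebra_simps)
qed auto

text \<open>
  Repeated integration by parts gives
  \<open>log_tail_integral M t x = t * \<integral>y\<ge>x. (ln y + euler_mascheroni) ^ M / y powr (t + 1)\<close>.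
\<close>

fun log_tail_integral :: "nat \<Rightarrow> real \<Rightarrow> real \<Rightarrow> real" where
  "log_tail_integral 0 t x = x powr (-t)"
| "log_tail_integral (Suc M) t x =
     (ln x + euler_mascheroni) ^ Suc M * x powr (-t) + real (Suc M) / t * log_tail_integral M t x"

text \<open>Differentiating the power of \<open>ln x + euler_mascheroni\<close> yields a term one
  exponent lower, which the derivative of the recursive summand cancels. What remains is minus the
  integrand.\<close>

lemma has_real_derivative_log_tail_integral:
  assumes "t > 0" "x > 0"
  shows "(log_tail_integral M t has_real_derivative - (t * (ln x + euler_mascheroni) ^ M * x powr (- t - 1))) (at x)"
proof (induction M)
  case 0
  show ?case
    using assms by (auto simp: log_tail_integral.simps[abs_def] intro!: derivative_eq_intros)
next
  case (Suc M)
  have *: "x powr (-t) / x = x powr (- t - 1)"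
    using assms by (simp add: powr_diff)
  show ?case
    unfolding log_tail_integral.simps[abs_def]
  proof (rule DERIV_cong)
    show "((\<lambda>x. (ln x + euler_mascheroni) ^ Suc M * x powr (-t) + real (Suc M) / t * log_tail_integral M t x)
        has_real_derivative
       (real (Suc M) * (ln x + euler_mascheroni) ^ M * (1 / x)) * x powr (-t)
       + (- t * x powr (- t - 1)) * (ln x + euler_mascheroni) ^ Suc M
       + real (Suc M) / t * (- (t * (ln x + euler_mascheroni) ^ M * x powr (- t - 1)))) (at x)"
      by (rule derivative_eq_intros Suc.IH refl assms | use assms in simp)+
    have "(real (Suc M) * (ln x + euler_mascheroni) ^ M * (1 / x)) * x powr (-t) =
        real (Suc M) * (ln x + euler_mascheroni) ^ M * x powr (- t - 1)"
      by (simp add: *[symmetric])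
    thus "(real (Suc M) * (ln x + euler_mascheroni) ^ M * (1 / x)) * x powr (-t)
       + (- t * x powr (- t - 1)) * (ln x + euler_mascheroni) ^ Suc M
       + real (Suc M) / t * (- (t * (ln x + euler_mascheroni) ^ M * x powr (- t - 1)))
       = - (t * (ln x + euler_mascheroni) ^ Suc M * x powr (- t - 1))"
      using assms by simp
  qed
qed

text \<open>Among the antiderivatives, vanishing at infinity singles out the tail integral, and it
  makes the differences over consecutive integers sum to the value at 1.\<close>

lemma log_tail_integral_tendsto_0:
  assumes "t > 0"
  shows "(\<lambda>n. log_tail_integral M t (real (Suc n))) \<longlonglongrightarrow> 0"
proof -
  have powr: "(\<lambda>n. real (Suc n) powr (-u)) \<longlonglongrightarrow> 0" if "u > 0" for u
    using that by (intro tendsto_neg_powr filterlim_compose[OF filterlim_real_sequentially filterlim_Suc]) auto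
  have log: "(\<lambda>n. (ln (real (Suc n)) + euler_mascheroni) ^ M * real (Suc n) powr (-t)) \<longlonglongrightarrow> 0" for M
  proof -
    obtain C where C: "C > 0" "\<And>n. norm ((harm (Suc n) :: complex) ^ M) \<le> C * real (Suc n) powr (t / 2)"
      using norm_harm_power_bound[of "t / 2" M] assms by auto
    have bound: "norm ((ln (real (Suc n)) + euler_mascheroni) ^ M * real (Suc n) powr (-t)) \<le> C * real (Suc n) powr (- (t / 2))" for n
    proof -
      \<comment> \<open>\<open>harm n - ln n\<close> decreases to its limit, so
        \<open>ln n + euler_mascheroni\<close> lies below \<open>harm n\<close> and inherits its
        growth bound.\<close>
      have "euler_mascheroni \<le> harm (Suc n) - ln (real (Suc n))"
        by (rule decseq_ge[OF decseq_harm_diff_ln])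
           (use LIMSEQ_Suc[OF euler_mascheroni_LIMSEQ] in simp)
      moreover have nn: "0 \<le> ln (real (Suc n)) + (euler_mascheroni :: real)"
        using euler_mascheroni_pos by (intro add_nonneg_nonneg) auto
      ultimately have "(ln (real (Suc n)) + euler_mascheroni) ^ M \<le> harm (Suc n) ^ M"
        by (intro power_mono) auto
      also have "\<dots> \<le> C * real (Suc n) powr (t / 2)"
        using C(2)[of n] by (simp add: norm_power norm_harm)
      finally have "(ln (real (Suc n)) + euler_mascheroni) ^ M * real (Suc n) powr (-t)
          \<le> C * real (Suc n) powr (t / 2) * real (Suc n) powr (-t)"
        by (intro mult_right_mono) auto
      also have "\<dots> = C * real (Suc n) powr (- (t / 2))"
        by (simp add: powr_add[symmetric] mult.assoc del: of_nat_Suc)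
      finally show ?thesis
        using nn by (simp add: abs_mult power_abs del: of_nat_Suc)
    qed
    have lim: "(\<lambda>n. C * real (Suc n) powr (- (t / 2))) \<longlonglongrightarrow> C * 0"
      using assms by (intro tendsto_mult tendsto_const powr) auto
    show ?thesis
      by (rule Lim_null_comparison[OF always_eventually[OF allI[OF bound]]]) (use lim in simp)
  qed
  show ?thesis
  proof (induction M)
    case 0
    show ?case using powr[OF assms] by simp
  next
    case (Suc M)
    have "(\<lambda>n. (ln (real (Suc n)) + euler_mascheroni) ^ Suc M * real (Suc n) powr (-t)
            + real (Suc M) / t * log_tail_integral M t (real (Suc n))) \<longlonglongrightarrow> 0 + real (Suc M) / t * 0"
      by (intro tendsto_add tendsto_mult tendsto_const log Suc.IH)
    thus ?case by simp
  qed
qed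

text \<open>Each difference of powers is the integral of \<open>t * x powr (- t - 1)\<close> over a
  unit interval, so each summand is compared with the piece of the logarithmic integral there. The
  error is \<open>t\<close> times a fixed multiple of \<open>Suc n powr (-3/2)\<close>, whose sum
  does not depend on \<open>t\<close>.\<close>

lemma harm_difference_series_approx:
  "\<exists>K. \<forall>t S. 0 < t \<longrightarrow>
     (\<lambda>n. harm (Suc n) ^ M * (real (Suc n) powr (-t) - real (Suc (Suc n)) powr (-t))) sums S \<longrightarrow>
     \<bar>S - log_tail_integral M t 1\<bar> \<le> K * t"
proof -
  obtain C where C: "C > 0" "\<And>n. norm ((harm (Suc n) :: complex) ^ M) \<le> C * real (Suc n) powr (1 / 2)"
    using norm_harm_power_bound[of "1 / 2" M] by auto
  \<comment> \<open>\<open>real M\<close> comes from the difference of powers,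
    \<open>2 ^ M * C\<close> from bounding \<open>(2 * h) ^ M\<close> by a multiple of a square
    root.\<close>
  define c where "c = real M * 2 ^ M * C"
  have c: "c \<ge> 0" using C by (simp add: c_def)
  have summable: "summable (\<lambda>n. real (Suc n) powr (-3/2))"
    using summable_real_powr_iff[of "-3/2"] by (subst summable_Suc_iff[of "\<lambda>n. real n powr (-3/2)"]) simp
  show ?thesis
  proof (intro exI allI impI)
    fix t S :: real
    assume t: "0 < t"
    define T where "T n = harm (Suc n) ^ M * (real (Suc n) powr (-t) - real (Suc (Suc n)) powr (-t))" for n
    define A where "A n = log_tail_integral M t (real (Suc n))" for n
    assume "(\<lambda>n. harm (Suc n) ^ M * (real (Suc n) powr (-t) - real (Suc (Suc n)) powr (-t))) sums S"
    hence "T sums S" by (simp only: T_def[abs_def])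
    moreover have "(\<lambda>n. A n - A (Suc n)) sums (A 0 - 0)"
      unfolding A_def by (rule telescope_sums'[OF log_tail_integral_tendsto_0[OF t]])
    ultimately have sums: "(\<lambda>n. T n - (A n - A (Suc n))) sums (S - log_tail_integral M t 1)"
      using sums_diff by (fastforce simp: A_def)
    have bound: "norm (T n - (A n - A (Suc n))) \<le> t * c * real (Suc n) powr (-3/2)" for n
    proof -
      define h :: real where "h = harm (Suc n)"
      \<comment> \<open>With \<open>h\<close> frozen, the increment of \<open>\<phi>\<close> over
        the interval is minus the \<open>n\<close>-th error, so a derivative bound controls that
        error.\<close>
      define \<phi> where "\<phi> x = h ^ M * x powr (-t) - log_tail_integral M t x" for x
      have h1: "h \<ge> 1" using harm_mono[of 1 "Suc n"] by (simp add: h_def harm_expand)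
      have "norm (\<phi> (real (Suc n) + 1) - \<phi> (real (Suc n))) \<le>
              (t * c * real (Suc n) powr (-3/2)) * norm (real (Suc n) + 1 - real (Suc n))"
      proof (rule field_differentiable_bound[where S = "{real (Suc n)..real (Suc n) + 1}"])
        fix x assume x: "x \<in> {real (Suc n)..real (Suc n) + 1}"
        hence x0: "x > 0" by auto
        let ?D = "- (t * x powr (- t - 1) * (h ^ M - (ln x + euler_mascheroni) ^ M))"
        have "(\<phi> has_real_derivative
           h ^ M * (- t * x powr (- t - 1)) - (- (t * (ln x + euler_mascheroni) ^ M * x powr (- t - 1)))) (at x)"
          unfolding \<phi>_def
          by (rule derivative_eq_intros has_real_derivative_log_tail_integral t x0 refl | use x0 in simp)+
        also have "h ^ M * (- t * x powr (- t - 1)) - (- (t * (ln x + euler_mascheroni) ^ M * x powr (- t - 1))) = ?D"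
          by (simp add: algebra_simps)
        finally have "(\<phi> has_real_derivative ?D) (at x)" .
        thus "(\<phi> has_real_derivative ?D) (at x within {real (Suc n)..real (Suc n) + 1})"
          by (rule has_field_derivative_at_within)
        have close: "\<bar>h - (ln x + euler_mascheroni)\<bar> \<le> 1 / real (Suc n)"
          unfolding h_def using x by (intro harm_ln_diff_bound) auto
        moreover have "1 / real (Suc n) \<le> 1" by simp
        ultimately have "\<bar>h - (ln x + euler_mascheroni)\<bar> \<le> 1" by linarith
        \<comment> \<open>\<open>2 * h\<close> bounds both bases, since
          \<open>ln x + euler_mascheroni\<close> differs from \<open>h \<ge> 1\<close> by at most
          1.\<close>
        hence "\<bar>h ^ M - (ln x + euler_mascheroni) ^ M\<bar> \<le> real M * (2 * h) ^ M * \<bar>h - (ln x + euler_mascheroni)\<bar>"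
          using h1 by (intro abs_power_diff_le) (auto simp: abs_le_iff)
        also have "\<dots> \<le> (real M * (2 ^ M * (C * real (Suc n) powr (1 / 2)))) * (1 / real (Suc n))"
        proof (intro mult_mono close)
          have "h ^ M \<le> C * real (Suc n) powr (1 / 2)"
            using C(2)[of n] by (simp add: h_def norm_power norm_harm)
          thus "(2 * h) ^ M \<le> 2 ^ M * (C * real (Suc n) powr (1 / 2))"
            unfolding power_mult_distrib by (intro mult_left_mono) auto
        qed (use C h1 in auto)
        also have "\<dots> = c * real (Suc n) powr (- 1 / 2)"
        proof -
          have E: "real (Suc n) powr (- 1 / 2) = real (Suc n) powr (1 / 2) * (1 / real (Suc n))"
            using powr_diff[of "real (Suc n)" "1 / 2" 1] by simp
          show ?thesis unfolding E c_def by (simp add: mult_ac del: of_nat_Suc)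
        qed
        finally have 1: "\<bar>h ^ M - (ln x + euler_mascheroni) ^ M\<bar> \<le> c * real (Suc n) powr (- 1 / 2)" .
        have "x powr (- t - 1) \<le> x powr (-1)"
          using x t by (intro powr_mono) auto
        also have "\<dots> \<le> real (Suc n) powr (-1)"
          using x by (intro powr_mono2') auto
        finally have 2: "x powr (- t - 1) \<le> real (Suc n) powr (-1)" .
        have "norm ?D = t * (x powr (- t - 1) * \<bar>h ^ M - (ln x + euler_mascheroni) ^ M\<bar>)"
          using t by (simp add: abs_mult)
        also have "\<dots> \<le> t * (real (Suc n) powr (-1) * (c * real (Suc n) powr (- 1 / 2)))"
          using t 1 2 by (intro mult_left_mono mult_mono) auto
        also have "\<dots> = t * c * real (Suc n) powr (-3/2)"
        proof -
          have E: "real (Suc n) powr (-3/2) = real (Suc n) powr (-1) * real (Suc n) powr (- 1 / 2)"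
            unfolding powr_add[symmetric] by simp
          show ?thesis unfolding E by (simp only: mult_ac)
        qed
        finally show "norm ?D \<le> t * c * real (Suc n) powr (-3/2)" .
      qed (simp_all add: convex_real_interval)
      moreover have "\<phi> (real (Suc n)) - \<phi> (real (Suc n) + 1) = T n - (A n - A (Suc n))"
        by (simp add: \<phi>_def T_def A_def h_def algebra_simps)
      ultimately show ?thesis
        by (simp add: norm_minus_commute)
    qed
    have summ: "summable (\<lambda>n. t * c * real (Suc n) powr (-3/2))"
      using summable by (rule summable_mult)
    have "\<bar>S - log_tail_integral M t 1\<bar> = norm (\<Sum>n. T n - (A n - A (Suc n)))"
      using sums_unique[OF sums] by simp
    also have "\<dots> \<le> (\<Sum>n. t * c * real (Suc n) powr (-3/2))"
      using bound summ by (rule norm_suminf_le)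
    also have "\<dots> = (c * (\<Sum>n. real (Suc n) powr (-3/2))) * t"
      using suminf_mult[OF summable, of "t * c"] by (simp add: mult_ac)
    finally show "\<bar>S - log_tail_integral M t 1\<bar> \<le> (c * (\<Sum>n. real (Suc n) powr (-3/2))) * t" .
  qed
qed

subsection \<open>The constant term\<close>

text \<open>By summation by parts, the combination is the sum of a series whose terms are real for
  real \<open>t\<close>, so the real estimate carries over.\<close>

lemma harm_series_combination_approx:
  "\<exists>K. \<forall>t>0. norm (0 ^ M + (\<Sum>i<M. - (of_nat (M choose i) * (-1) ^ (M - i)) *
       harm_series i (of_real t + of_nat (M - i))) - of_real (log_tail_integral M t 1)) \<le> K * t"
proof -
  obtain K where K: "\<And>t S. 0 < t \<Longrightarrow>
     (\<lambda>n. harm (Suc n) ^ M * (real (Suc n) powr (-t) - real (Suc (Suc n)) powr (-t))) sums S \<Longrightarrow>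
     \<bar>S - log_tail_integral M t 1\<bar> \<le> K * t"
    using harm_difference_series_approx[of M] by blast
  show ?thesis
  proof (intro exI allI impI)
    fix t :: real assume t: "t > 0"
    define V where "V = 0 ^ M + (\<Sum>i<M. - (of_nat (M choose i) * (-1) ^ (M - i)) *
       harm_series i (of_real t + of_nat (M - i)))"
    define T where "T n = harm (Suc n) ^ M * (real (Suc n) powr (-t) - real (Suc (Suc n)) powr (-t))" for n
    have *: "1 / of_nat (Suc n) powr of_real t = complex_of_real (real (Suc n) powr (-t))" for n
    proof -
      have "complex_of_real (real (Suc n) powr (-t)) = of_real (real (Suc n)) powr of_real (-t)"
        by (rule powr_of_real[symmetric]) auto
      also have "\<dots> = 1 / of_nat (Suc n) powr of_real t"
        by (simp add: powr_minus divide_inverse del: of_nat_Suc)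
      finally show ?thesis ..
    qed
    have "(\<lambda>n. harm (Suc n) ^ M * (1 / of_nat (Suc n) powr of_real t - 1 / of_nat (Suc (Suc n)) powr of_real t)) sums V"
      unfolding V_def using t by (intro Dirichlet_difference_sums) auto
    also have "(\<lambda>n. harm (Suc n) ^ M * (1 / of_nat (Suc n) powr of_real t - 1 / of_nat (Suc (Suc n)) powr of_real t))
        = (\<lambda>n. complex_of_real (T n))"
      unfolding * T_def by (simp add: of_real_harm)
    finally have sums: "(\<lambda>n. complex_of_real (T n)) sums V" .
    hence Re: "T sums Re V"
      using sums_Re[OF sums] by simp
    hence "V = of_real (Re V)"
      using sums sums_of_real sums_unique2 by blast
    moreover have "\<bar>Re V - log_tail_integral M t 1\<bar> \<le> K * t"
      using K[OF t] Re by (simp add: T_def[abs_def])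
    ultimately show "norm (V - of_real (log_tail_integral M t 1)) \<le> K * t"
      by (metis norm_of_real of_real_diff)
  qed
qed

text \<open>At \<open>x = 1\<close> the logarithm vanishes and the recursion only multiplies by
  \<open>(M + 1) / t\<close> and adds \<open>euler_mascheroni ^ (M + 1)\<close>. The result is a
  polynomial in \<open>1 / t\<close>.\<close>

lemma log_tail_integral_1_laurent:
  obtains A L where "A has_laurent_expansion L" "fls_nth L 0 = euler_mascheroni ^ M"
    "\<And>t::real. t > 0 \<Longrightarrow> A (of_real t) = of_real (log_tail_integral M t 1)"
proof -
  \<comment> \<open>The induction also carries the vanishing of all positive coefficients: division
    by \<open>t\<close> moves the coefficient of index 1 to index 0.\<close>
  have "\<exists>A L. A has_laurent_expansion L \<and> fls_nth L 0 = euler_mascheroni ^ M \<and> (\<forall>k>0. fls_nth L k = 0) \<and>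
    (\<forall>t::real. t > 0 \<longrightarrow> A (of_real t) = of_real (log_tail_integral M t 1))"
  proof (induction M)
    case 0
    show ?case
      by (intro exI[of _ "\<lambda>_. 1"] exI[of _ 1] conjI) auto
  next
    case (Suc M)
    then obtain A L where A: "A has_laurent_expansion L" "fls_nth L 0 = euler_mascheroni ^ M"
      "\<And>k. k > 0 \<Longrightarrow> fls_nth L k = 0"
      "\<And>t::real. t > 0 \<Longrightarrow> A (of_real t) = of_real (log_tail_integral M t 1)"
      by blast
    define A' where "A' w = euler_mascheroni ^ Suc M + of_nat (Suc M) * (A w * w powi (-1))" for w
    define L' where "L' = fls_const (euler_mascheroni ^ Suc M) + fls_const (of_nat (Suc M)) * fls_shift 1 L"
    have "A' has_laurent_expansion L'"
      unfolding A'_def L'_def by (intro laurent_expansion_intros A)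
    moreover have "A' (of_real t) = of_real (log_tail_integral (Suc M) t 1)" if "t > 0" for t :: real
      using A(4)[OF that] by (simp add: A'_def power_int_minus field_simps)
    moreover have nth: "fls_nth L' k = (if k = 0 then euler_mascheroni ^ Suc M else 0)" if "k \<ge> 0" for k
      using that A(3)[of "k + 1"] by (simp add: L'_def)
    hence "fls_nth L' 0 = euler_mascheroni ^ Suc M" "\<forall>k>0. fls_nth L' k = 0"
      by auto
    ultimately show ?case
      by blast
  qed
  thus ?thesis using that by blast
qed

text \<open>A pole would force the function to infinity along every approach, so a finite limit
  along the positive reals already excludes it and determines the constant term.\<close>

lemma fls_nth_0_eqI:
  assumes f: "f has_laurent_expansion F" and lim: "((\<lambda>t. f (of_real t)) \<longlongrightarrow> c) (at_right (0::real))"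
  shows "fls_nth F 0 = c"
proof -
  have at: "filterlim of_real (at (0::complex)) (at_right (0::real))"
    unfolding filterlim_at
    by (auto intro!: tendsto_eq_intros simp: eventually_at_filter)
  have "\<not>fls_subdegree F < 0"
  proof
    assume "fls_subdegree F < 0"
    with f have "filterlim f at_infinity (at 0)"
      by (rule has_laurent_expansion_imp_filterlim_infinity_0)
    hence "filterlim (\<lambda>t. f (of_real t)) at_infinity (at_right (0::real))"
      using at by (rule filterlim_compose)
    with lim show False
      using not_tendsto_and_filterlim_at_infinity[of "at_right (0::real)"] by simp
  qed
  hence "f \<midarrow>0\<rightarrow> fls_nth F 0"
    using f by (intro has_laurent_expansion_imp_tendsto_0) auto
  hence "((\<lambda>t. f (of_real t)) \<longlongrightarrow> fls_nth F 0) (at_right (0::real))"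
    using at by (rule filterlim_compose)
  with lim show ?thesis
    using tendsto_unique[of "at_right (0::real)"] by simp
qed

section \<open>Laurent coefficients of the continued functions\<close>

lemma harm_zeta_laurent:
  "(\<lambda>w. harm_zeta j (w + z)) has_laurent_expansion laurent_expansion (harm_zeta j) z"
proof -
  have "harm_zeta j meromorphic_on {z}"
    by (rule meromorphic_on_subset[of _ UNIV])
       (use nicely_meromorphic_harm_zeta in \<open>auto simp: nicely_meromorphic_on_def\<close>)
  hence "(\<lambda>w. harm_zeta j (z + w)) has_laurent_expansion laurent_expansion (harm_zeta j) z"
    by (intro not_essential_has_laurent_expansion) (auto simp: meromorphic_at_iff)
  thus ?thesis by (simp add: add.commute)
qed

lemma harm_zeta_laurent_nth_0:
  assumes "1 < Re z"
  shows "fls_nth (laurent_expansion (harm_zeta j) z) 0 = harm_zeta j z"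
proof -
  have "harm_zeta j holomorphic_on {s. 1 < Re s}"
    using holomorphic_harm_series[of j] harm_zeta_eq_series
    by (subst holomorphic_cong[of _ _ "harm_zeta j" "harm_series j"]) auto
  hence "harm_zeta j analytic_on {z}"
    using assms open_halfspace_Re_gt[of 1] by (auto simp: analytic_at)
  then obtain P where P: "(\<lambda>w. harm_zeta j (z + w)) has_fps_expansion P"
    using analytic_at_imp_has_fps_expansion by blast
  hence "laurent_expansion (harm_zeta j) z = fps_to_fls P"
    by (intro laurent_expansion_eqI has_laurent_expansion_fps)
  thus ?thesis
    using has_fps_expansion_imp_0_eq_fps_nth_0[OF P] by simp
qed

text \<open>For \<open>M = m + 1\<close>, constant terms at \<open>t = 0\<close> are compared. Only
  the term \<open>i = m\<close> sits at the argument 1, where it contributes the Stieltjes constant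
  with weight \<open>M\<close>; the terms \<open>i < m\<close> sit at arguments at least 2 and
  contribute their values.\<close>

lemma harm_stieltjes_0_relation:
  defines "c \<equiv> \<lambda>M i. - (of_nat (M choose i) * (-1) ^ (M - i))"
  shows "of_nat (Suc m) * harm_stieltjes m 0 +
         (\<Sum>i<m. c (Suc m) i * harm_zeta i (of_nat (Suc m - i))) = euler_mascheroni ^ Suc m"
proof -
  define M where "M = Suc m"
  obtain A L where A: "A has_laurent_expansion L" "fls_nth L 0 = euler_mascheroni ^ M"
    "\<And>t::real. t > 0 \<Longrightarrow> A (of_real t) = of_real (log_tail_integral M t 1)"
    using log_tail_integral_1_laurent[of M] by blast
  define Z where "Z i = laurent_expansion (harm_zeta i) (of_nat (M - i))" for i
  \<comment> \<open>All principal parts cancel in \<open>h\<close>: it tends to 0 along positive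
    reals, so its constant coefficient is 0.\<close>
  define h where "h w = (\<Sum>i<M. c M i * harm_zeta i (w + of_nat (M - i))) - A w" for w
  have "h has_laurent_expansion (\<Sum>i<M. fls_const (c M i) * Z i) - L"
    unfolding h_def Z_def by (intro laurent_expansion_intros harm_zeta_laurent A)
  moreover have "((\<lambda>t. h (of_real t)) \<longlongrightarrow> 0) (at_right (0::real))"
  proof -
    obtain K where K: "\<And>t. t > 0 \<Longrightarrow> norm (0 ^ M + (\<Sum>i<M. c M i *
       harm_series i (of_real t + of_nat (M - i))) - of_real (log_tail_integral M t 1)) \<le> K * t"
      using harm_series_combination_approx[of M] unfolding c_def by blast
    have "norm (h (of_real t)) \<le> K * t" if t: "t > 0" for t
    proof -
      have "harm_zeta i (of_real t + of_nat (M - i)) = harm_series i (of_real t + of_nat (M - i))" if "i < M" for i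
        using that t by (intro harm_zeta_eq_series) auto
      \<comment> \<open>The boundary term \<open>0 ^ M\<close> is 0 because
        \<open>M = Suc m\<close>.\<close>
      hence "h (of_real t) = 0 ^ M + (\<Sum>i<M. c M i *
       harm_series i (of_real t + of_nat (M - i))) - of_real (log_tail_integral M t 1)"
        using A(3)[OF t] by (simp add: h_def M_def)
      thus ?thesis using K[OF t] by simp
    qed
    hence "eventually (\<lambda>t. norm (h (of_real t)) \<le> K * t) (at_right 0)"
      by (auto simp: eventually_at_filter)
    moreover have "((\<lambda>t. K * t) \<longlongrightarrow> 0) (at_right 0)"
      by (auto intro!: tendsto_eq_intros)
    ultimately show ?thesis
      by (rule Lim_null_comparison)
  qed
  ultimately have "fls_nth ((\<Sum>i<M. fls_const (c M i) * Z i) - L) 0 = 0"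
    by (rule fls_nth_0_eqI)
  hence "(\<Sum>i<M. c M i * fls_nth (Z i) 0) = euler_mascheroni ^ M"
    by (simp add: A(2) fls_nth_sum)
  moreover have "fls_nth (Z m) 0 = harm_stieltjes m 0"
    by (simp add: harm_stieltjes_def Z_def M_def)
  moreover have "c M m = of_nat M"
    by (simp add: c_def M_def)
  moreover have "fls_nth (Z i) 0 = harm_zeta i (of_nat (M - i))" if "i < m" for i
    unfolding Z_def using that by (intro harm_zeta_laurent_nth_0) (auto simp: M_def)
  ultimately show ?thesis
    by (simp add: M_def add.commute)
qed

theorem theorem5:
  fixes m :: nat
  assumes "m \<ge> 1"
  shows "harm_stieltjes m 0 =
           euler_mascheroni ^ (m + 1) / of_nat (m + 1)
           + (-1) ^ (m + 1) * (riemann_zeta (of_nat (m + 1)) / of_nat (m + 1))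
           + (\<Sum>k | k + 2 \<le> m. of_nat ((m + 1) choose (k + 1)) *
                ((-1) ^ (k + m) * harm_zeta (k + 1) (of_nat (m - k)) / of_nat (m + 1)))"
proof -
  obtain p where p: "m = Suc p" using assms by (cases m) auto
  define N :: complex where "N = of_nat (m + 1)"
  have N: "N \<noteq> 0" unfolding N_def by (simp del: of_nat_add of_nat_Suc)
  define a where "a i = of_nat ((m + 1) choose i) * (-1) ^ (m + 1 - i) * harm_zeta i (of_nat (m + 1 - i))" for i
  have "N * harm_stieltjes m 0 - (\<Sum>i<m. a i) = euler_mascheroni ^ (m + 1)"
    using harm_stieltjes_0_relation[of m] by (simp add: N_def a_def sum_negf)
  hence "harm_stieltjes m 0 = (euler_mascheroni ^ (m + 1) + (\<Sum>i<m. a i)) / N"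
    using N by (simp add: field_simps)
  \<comment> \<open>The term \<open>i = 0\<close> supplies the zeta value; the others are reindexed
    by \<open>i = k + 1\<close>.\<close>
  also have "(\<Sum>i<m. a i) = a 0 + (\<Sum>k<p. a (Suc k))"
    unfolding p by (rule sum.lessThan_Suc_shift)
  also have "a 0 = (-1) ^ (m + 1) * riemann_zeta N"
    by (simp add: a_def N_def riemann_zeta_eq_harm_zeta)
  also have "(\<Sum>k<p. a (Suc k)) =
      (\<Sum>k | k + 2 \<le> m. of_nat ((m + 1) choose (k + 1)) * ((-1) ^ (k + m) * harm_zeta (k + 1) (of_nat (m - k))))"
  proof (rule sum.cong)
    fix k assume "k \<in> {k. k + 2 \<le> m}"
    \<comment> \<open>\<open>m - k\<close> and \<open>k + m\<close> have the same parity.\<close>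
    hence "(-1) ^ (m + 1 - Suc k) = (-1 :: complex) ^ (k + m)"
      by (auto simp: minus_one_power_iff)
    thus "a (Suc k) = of_nat ((m + 1) choose (k + 1)) * ((-1) ^ (k + m) * harm_zeta (k + 1) (of_nat (m - k)))"
      by (simp add: a_def)
  qed (auto simp: p)
  finally show ?thesis
    unfolding N_def add_divide_distrib sum_divide_distrib
    by (simp only: add.assoc times_divide_eq_right)
qed

end
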